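(* Let $K\subset\mathbb{R}^n$ be a closed convex set containing the origin in its interior. Then $K=\{x\in\mathbb{R}^n\mid \rho_K(x)\leq 1\}$.
   Context: $\langle\cdot,\cdot\rangle$ is the standard inner product on $\mathbb{R}^n$. The polar of $K\subseteq\mathbb{R}^n$ is $K^* = \{y\in\mathbb{R}^n\mid \langle x,y \rangle \leq 1 \text{ for all } x\in K\}$, and $\hat K = \{y\in K^* \mid \langle x,y \rangle = 1 \text{ for some } x\in K\}$. The function $\rho_K$ is the support function of $\hat K$: $\rho_K(x)=\sup_{y\in \hat K}\langle x,y\rangle$, the supremum being taken in the extended reals, with the supremum over the empty set equal to $-\infty$ (this only matters when $K=\mathbb{R}^n$, where $\hat K=\emptyset$). *)

theory Defs
  imports "HOL-Analysis.Analysis"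
begin

definition polar :: "'a::real_inner set \<Rightarrow> 'a set" where
  "polar K = {y. \<forall>x\<in>K. x \<bullet> y \<le> 1}"

definition polar_hat :: "'a::real_inner set \<Rightarrow> 'a set" where
  "polar_hat K = {y \<in> polar K. \<exists>x\<in>K. x \<bullet> y = 1}"

(* In the complete lattice ereal the supremum of the empty set is -\<infinity>. *)
definition support_function :: "'a::real_inner set \<Rightarrow> 'a \<Rightarrow> ereal" where
  "support_function S x = (SUP y\<in>S. ereal (x \<bullet> y))"

definition rho :: "'a::real_inner set \<Rightarrow> 'a \<Rightarrow> ereal" where
  "rho K = support_function (polar_hat K)"

end

theory Submission
  imports Defs
begin

text \<open>The inclusion of \<open>K\<close> is immediate from \<open>polar_hat K \<subseteq> polar K\<close>. Conversely, if \<open>z \<notin> K\<close>, the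
  hyperplane through the point \<open>y\<close> of \<open>K\<close> nearest to \<open>z\<close> separates \<open>z\<close> from \<open>K\<close> and supports \<open>K\<close> at
  \<open>y\<close>. As \<open>0\<close> is an interior point, it misses \<open>0\<close>, so it is \<open>{x. x \<bullet> w = 1}\<close> for some \<open>w\<close>,
  and then \<open>w \<in> polar_hat K\<close> with \<open>z \<bullet> w > 1\<close>.\<close>

text \<open>The case of empty \<open>polar_hat K\<close> is included: the supremum is then
  \<open>-\<infinity>\<close> and the right side is vacuous.\<close>

lemma rho_le_one_iff: "rho K x \<le> 1 \<longleftrightarrow> (\<forall>y\<in>polar_hat K. x \<bullet> y \<le> 1)"
  by (simp add: rho_def support_function_def SUP_le_iff)

text \<open>A small ball around \<open>0\<close> inside \<open>K\<close> contains a negative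
  multiple of \<open>a\<close>, whose inner product with \<open>a\<close> is negative.\<close>

lemma lower_bound_neg_if_zero_interior:
  fixes a :: "'a::real_inner"
  assumes "0 \<in> interior K" and "a \<noteq> 0" and bound: "\<And>x. x \<in> K \<Longrightarrow> b \<le> a \<bullet> x"
  shows "b < 0"
proof -
  obtain e where "e > 0" and e: "cball 0 e \<subseteq> K"
    using \<open>0 \<in> interior K\<close> by (auto simp: mem_interior_cball)
  define x where "x = - (e / norm a) *\<^sub>R a"
  have "norm x = e"
    using \<open>e > 0\<close> \<open>a \<noteq> 0\<close> by (simp add: x_def)
  then have "b \<le> a \<bullet> x"
    using e by (intro bound) auto
  also have "a \<bullet> x < 0"
    using \<open>e > 0\<close> \<open>a \<noteq> 0\<close> by (simp add: x_def)
  finally show ?thesis .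
qed

lemma polar_hat_separates:
  fixes K :: "'a::{real_inner,heine_borel} set"
  assumes "closed K" and "convex K" and "0 \<in> interior K" and "z \<notin> K"
  obtains w where "w \<in> polar_hat K" and "z \<bullet> w > 1"
proof -
  have "K \<noteq> {}"
    using \<open>0 \<in> interior K\<close> interior_subset by blast
  with assms obtain a b y where "y \<in> K" and z: "a \<bullet> z < b" and y: "a \<bullet> y = b"
      and K: "\<And>x. x \<in> K \<Longrightarrow> b \<le> a \<bullet> x"
    by (metis supporting_hyperplane_closed_point)
  have "a \<noteq> 0"
    using z y by auto
  then have "b < 0"
    using \<open>0 \<in> interior K\<close> K lower_bound_neg_if_zero_interior by blast
  \<comment> \<open>Dividing by \<open>b\<close> normalises the hyperplane to level
    \<open>1\<close>. As \<open>b < 0\<close>, the inequalities flip: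
    \<open>b \<le> a \<bullet> x\<close> becomes \<open>x \<bullet> w \<le> 1\<close>, and
    \<open>a \<bullet> z < b\<close> becomes \<open>z \<bullet> w > 1\<close>.\<close>
  define w where "w = (1 / b) *\<^sub>R a"
  have w: "x \<bullet> w = (a \<bullet> x) / b" for x
    by (simp add: w_def inner_commute)
  have "w \<in> polar_hat K"
    using \<open>b < 0\<close> \<open>y \<in> K\<close> y K by (auto simp: polar_hat_def polar_def w divide_le_eq intro!: bexI[of _ y])
  moreover have "z \<bullet> w > 1"
    using \<open>b < 0\<close> z by (simp add: w less_divide_eq)
  ultimately show thesis
    by (rule that)
qed

theorem corollary5:
  fixes K :: "(real ^ 'n) set"
  assumes "closed K" and "convex K" and "0 \<in> interior K"
  shows "K = {x. rho K x \<le> 1}"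
proof (intro equalityI subsetI CollectI)
  fix x assume "x \<in> K"
  then show "rho K x \<le> 1"
    by (auto simp: rho_le_one_iff polar_hat_def polar_def)
next
  fix x assume "x \<in> {x. rho K x \<le> 1}"
  then have "x \<bullet> y \<le> 1" if "y \<in> polar_hat K" for y
    using that by (simp add: rho_le_one_iff)
  then show "x \<in> K"
    using polar_hat_separates[OF assms] by (metis not_le)
qed

end
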